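(* Let $n\ge 3$, let $M,N\in\mathbb{Z}^{n-1}$ and let $D=(D_1,\dots,D_{n-1})$ be a tuple of positive integers. If $D_{n-1}=1$, then the long Weyl element Kloosterman sums satisfy $$S_n(M,N;D)=S_{n-1}\big((M_1,\dots,M_{n-2}),(N_1,\dots,N_{n-2});(D_1,\dots,D_{n-2})\big).$$
   Context: Definition of $S_n(M,N;D)$ for any $n\ge2$, $M,N\in\mathbb{Z}^{n-1}$ and $D$ an $(n-1)$-tuple of positive integers: $e(z)=e^{2\pi i z}$. $U$ is the group of upper triangular unipotent $n\times n$ matrices. For $N\in\mathbb{Z}^{n-1}$, $\psi_N$ is the character of $U(\mathbb{R})$, trivial on $U(\mathbb{Z})$, given by $\psi_N(u)=e(N_1u_{1,2}+N_2u_{2,3}+\cdots+N_{n-1}u_{n-1,n})$. For $M\in \mathbb{Z}^{n-1}$, $\tilde M=(M_{n-1},\dots,M_1)$. Let $w_0$ be the long Weyl element: the $n\times n$ matrix whose only nonzero entries are on the anti-diagonal, the entry at position $(n-k+1,k)$ being $(-1)^{k-1}$ ($1\le k\le n$). Let $c=\mathrm{Diag}(1/D_{n-1},\,D_{n-1}/D_{n-2},\dots,D_2/D_1,\,D_1)$, $C(c)=U(\mathbb{R})\,c\,w_0\,U(\mathbb{R})\cap SL(n,\mathbb{Z})$ and $X(c)=U(\mathbb{Z})\backslash C(c)/U(\mathbb{Z})$. Each $\gamma\in C(c)$ is uniquely $\gamma=b_1cw_0b_2$ with $b_1,b_2\in U(\mathbb{R})$; set $\mu(\gamma)=b_1\in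 U(\mathbb{Z})\backslash U(\mathbb{R})$ and $\mu'(\gamma)=b_2\in U(\mathbb{R})/U(\mathbb{Z})$. Then $$S_n(M,N;D)=\sum_{x\in X(c)}\psi_{\tilde M}(\mu(x))\,\psi_N(\mu'(x)).$$ *)

theory Defs
  imports Complex_Main "Jordan_Normal_Form.Determinant"
begin

text \<open>
  Tuples indexed by 1, ..., n-1 are lists of length n-1, so the entry with index k is
  \<open>xs ! (k - 1)\<close>.  Matrices are indexed from 0, so the entry in row i and column j of the
  mathematical matrix is \<open>A $$ (i - 1, j - 1)\<close>.
\<close>

definition e_unit :: "complex \<Rightarrow> complex" where
  "e_unit z = exp (2 * of_real pi * \<i> * z)"

definition unip_real :: "nat \<Rightarrow> real mat set" where
  "unip_real n = {u \<in> carrier_mat n n. upper_triangular u \<and> (\<forall>i<n. u $$ (i, i) = 1)}"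

definition unip_int :: "nat \<Rightarrow> real mat set" where
  "unip_int n = {u \<in> unip_real n. elements_mat u \<subseteq> \<int>}"

definition SL_int :: "nat \<Rightarrow> real mat set" where
  "SL_int n = {g \<in> carrier_mat n n. elements_mat g \<subseteq> \<int> \<and> det g = 1}"

definition psi :: "nat \<Rightarrow> int list \<Rightarrow> real mat \<Rightarrow> complex" where
  "psi n N u = e_unit (of_real (\<Sum>i<n-1. of_int (N ! i) * u $$ (i, Suc i)))"

text \<open>Entry \<open>(-1)^(k-1)\<close> at the one-based position (n-k+1, k).\<close>

definition long_weyl :: "nat \<Rightarrow> real mat" where
  "long_weyl n = mat n n (\<lambda>(i, j). if i + j + 1 = n then (-1) ^ j else 0)"

text \<open>
  The tuple D extended by \<open>D_0 = D_n = 1\<close>; with this convention the k-th diagonal entry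
  (counted from 1) of \<open>Diag(1/D_{n-1}, D_{n-1}/D_{n-2}, ..., D_2/D_1, D_1)\<close> is
  \<open>D_{n-k+1} / D_{n-k}\<close> for all k.
\<close>

definition D_ext :: "nat \<Rightarrow> nat list \<Rightarrow> nat \<Rightarrow> nat" where
  "D_ext n D k = (if k = 0 \<or> k = n then 1 else D ! (k - 1))"

definition c_mat :: "nat \<Rightarrow> nat list \<Rightarrow> real mat" where
  "c_mat n D = mat_diag n (\<lambda>i. real (D_ext n D (n - i)) / real (D_ext n D (n - i - 1)))"

definition big_cell :: "nat \<Rightarrow> nat list \<Rightarrow> real mat set" where
  "big_cell n D =
     {b1 * c_mat n D * long_weyl n * b2 | b1 b2. b1 \<in> unip_real n \<and> b2 \<in> unip_real n}
     \<inter> SL_int n"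

definition dbl_coset :: "nat \<Rightarrow> real mat \<Rightarrow> real mat set" where
  "dbl_coset n g = {u * g * v | u v. u \<in> unip_int n \<and> v \<in> unip_int n}"

definition X_set :: "nat \<Rightarrow> nat list \<Rightarrow> real mat set set" where
  "X_set n D = dbl_coset n ` big_cell n D"

text \<open>
  The Bruhat factors of an element of the big cell.  They are unique since all entries of D
  are positive.
\<close>

definition mu :: "nat \<Rightarrow> nat list \<Rightarrow> real mat \<Rightarrow> real mat" where
  "mu n D g = (THE b1. b1 \<in> unip_real n \<and>
     (\<exists>b2 \<in> unip_real n. g = b1 * c_mat n D * long_weyl n * b2))"

definition mu' :: "nat \<Rightarrow> nat list \<Rightarrow> real mat \<Rightarrow> real mat" where
  "mu' n D g = (THE b2. b2 \<in> unip_real n \<and>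
     (\<exists>b1 \<in> unip_real n. g = b1 * c_mat n D * long_weyl n * b2))"

text \<open>
  The summand is evaluated at a representative g of the double coset x.  Passing from g to
  \<open>u * g * v\<close> with integral unipotent u, v multiplies \<open>mu\<close> by u on the left and \<open>mu'\<close> by v on
  the right, and the characters are trivial on integral matrices, so the choice is immaterial.
  The set \<open>X_set n D\<close> is finite for positive D, so that \<open>sum\<close> has its ordinary meaning.
\<close>

definition kloosterman :: "nat \<Rightarrow> int list \<Rightarrow> int list \<Rightarrow> nat list \<Rightarrow> complex" where
  "kloosterman n M N D =
     (\<Sum>x \<in> X_set n D. let g = (SOME g. g \<in> x)
        in psi n (rev M) (mu n D g) * psi n N (mu' n D g))"

end

theory Submission
  imports Defs
begin

text \<open>
  Write \<open>n = m + 1\<close>.  Since \<open>D_m = 1\<close>, the lower left \<open>m \<times> m\<close> block \<open>h\<close> of an element of the big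
  cell for \<open>D\<close> has determinant 1, and it lies in the big cell for \<open>(D_1, ..., D_(m-1))\<close>.  As \<open>h\<close> is
  invertible over the integers, integral unipotent row and column operations clear the first row
  and the last column, so every double coset contains the matrix with blocks \<open>0, (-1)^m, h, 0\<close>.
  Hence \<open>g \<mapsto> h\<close> induces a bijection of double cosets.  On these representatives the Bruhat factors
  are those of \<open>h\<close> bordered by a unit vector, and the characters do not see the border.
\<close>

section \<open>Integral and unipotent matrices\<close>

lemma mult_mat_index:
  assumes "A \<in> carrier_mat p q" "B \<in> carrier_mat q r" "i < p" "j < r"
  shows "(A * B) $$ (i, j) = (\<Sum>k<q. A $$ (i, k) * B $$ (k, j))"
  using assms by (auto simp: scalar_prod_def atLeast0LessThan intro!: sum.cong)

lemma elements_mat_subset_iff: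
  assumes "A \<in> carrier_mat p q"
  shows "elements_mat A \<subseteq> S \<longleftrightarrow> (\<forall>i<p. \<forall>j<q. A $$ (i, j) \<in> S)"
proof
  assume "elements_mat A \<subseteq> S"
  then show "\<forall>i<p. \<forall>j<q. A $$ (i, j) \<in> S"
    using elements_matI[OF assms] by blast
next
  assume "\<forall>i<p. \<forall>j<q. A $$ (i, j) \<in> S"
  then show "elements_mat A \<subseteq> S"
    using assms by (auto dest!: elements_matD)
qed

lemma Ints_mult_mat:
  fixes A B :: "'a :: comm_ring_1 mat"
  assumes A: "A \<in> carrier_mat p q" and B: "B \<in> carrier_mat q r"
    and "elements_mat A \<subseteq> \<int>" "elements_mat B \<subseteq> \<int>"
  shows "elements_mat (A * B) \<subseteq> \<int>"
proof -
  have "A * B \<in> carrier_mat p r" using A B by simp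
  then show ?thesis
    using assms(3,4) unfolding elements_mat_subset_iff[OF A] elements_mat_subset_iff[OF B]
    by (subst elements_mat_subset_iff)
      (auto simp: mult_mat_index[OF A B] simp del: index_mult_mat intro!: Ints_sum Ints_mult)
qed

lemma Ints_det:
  fixes A :: "'a :: comm_ring_1 mat"
  assumes A: "A \<in> carrier_mat p p" and Z: "elements_mat A \<subseteq> \<int>"
  shows "det A \<in> \<int>"
  unfolding det_def'[OF A]
proof (intro Ints_sum Ints_mult Ints_prod)
  fix s assume "s \<in> {s. s permutes {0..<p}}"
  then show "A $$ (i, s i) \<in> \<int>" if "i \<in> {0..<p}" for i
    using Z that permutes_in_image[of s "{0..<p}" i]
    unfolding elements_mat_subset_iff[OF A] by auto
qed (auto simp: sign_def)

text \<open>Entries of the adjugate are signed minors. For determinant 1 the adjugate is the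
  inverse, so this supplies the integral inverses used below.\<close>

lemma Ints_adj_mat:
  fixes A :: "'a :: comm_ring_1 mat"
  assumes A: "A \<in> carrier_mat p p" and Z: "elements_mat A \<subseteq> \<int>"
  shows "elements_mat (adj_mat A) \<subseteq> \<int>"
proof -
  have "cofactor A j i \<in> \<int>" if "i < p" "j < p" for i j
  proof -
    have d: "mat_delete A j i \<in> carrier_mat (p - 1) (p - 1)"
      using A by (rule mat_delete_carrier)
    have "elements_mat (mat_delete A j i) \<subseteq> \<int>"
      using Z A unfolding elements_mat_subset_iff[OF A] elements_mat_subset_iff[OF d]
      by (auto simp: mat_delete_def)
    then show ?thesis
      unfolding cofactor_def by (intro Ints_mult Ints_power Ints_det[OF d]) auto
  qed
  then show ?thesis
    using adj_mat(1)[OF A] A by (subst elements_mat_subset_iff) (auto simp: adj_mat_def)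
qed

section \<open>The real and integral unipotent groups\<close>

lemma unip_realD:
  assumes "u \<in> unip_real n"
  shows "u \<in> carrier_mat n n" "i < n \<Longrightarrow> u $$ (i, i) = 1"
    "j < i \<Longrightarrow> i < n \<Longrightarrow> u $$ (i, j) = 0"
  using assms by (auto simp: unip_real_def)

lemma unip_realI:
  assumes "u \<in> carrier_mat n n" "\<And>i. i < n \<Longrightarrow> u $$ (i, i) = 1"
    "\<And>i j. j < i \<Longrightarrow> i < n \<Longrightarrow> u $$ (i, j) = 0"
  shows "u \<in> unip_real n"
  using assms by (auto simp: unip_real_def)

lemma unip_intD:
  assumes "u \<in> unip_int n"
  shows "u \<in> unip_real n" "u \<in> carrier_mat n n" "elements_mat u \<subseteq> \<int>"
  using assms by (auto simp: unip_int_def unip_real_def)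

lemma det_unip_real:
  assumes "u \<in> unip_real n"
  shows "det u = 1"
proof -
  have "det u = prod_list (diag_mat u)"
    using assms by (intro det_upper_triangular[of _ n]) (auto simp: unip_real_def)
  also have "\<dots> = 1"
    using unip_realD[OF assms] by (auto simp: prod_list_diag_prod)
  finally show ?thesis .
qed

lemma one_in_unip_real: "1\<^sub>m n \<in> unip_real n"
  by (rule unip_realI) auto

lemma one_in_unip_int: "1\<^sub>m n \<in> unip_int n"
  using one_in_unip_real elements_mat_subset_iff[of "1\<^sub>m n :: real mat" n n \<int>]
  by (auto simp: unip_int_def)

lemma unip_real_mult:
  assumes u: "u \<in> unip_real n" and v: "v \<in> unip_real n"
  shows "u * v \<in> unip_real n"
proof (rule unip_realI)
  note uc = unip_realD(1)[OF u] and vc = unip_realD(1)[OF v]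
  show "u * v \<in> carrier_mat n n" using uc vc by simp
  fix i assume i: "i < n"
  have "(u * v) $$ (i, i) = (\<Sum>k<n. if k = i then 1 else 0)"
    unfolding mult_mat_index[OF uc vc i i]
  proof (rule sum.cong[OF refl])
    fix k assume "k \<in> {..<n}"
    then show "u $$ (i, k) * v $$ (k, i) = (if k = i then 1 else 0)"
      using i unip_realD[OF u] unip_realD[OF v] by (cases k i rule: linorder_cases) auto
  qed
  then show "(u * v) $$ (i, i) = 1" using i by simp
next
  note uc = unip_realD(1)[OF u] and vc = unip_realD(1)[OF v]
  fix i j assume ij: "j < i" "i < n"
  then have j: "j < n" by simp
  show "(u * v) $$ (i, j) = 0"
    unfolding mult_mat_index[OF uc vc ij(2) j]
  proof (rule sum.neutral, rule ballI)
    fix k assume "k \<in> {..<n}"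
    then show "u $$ (i, k) * v $$ (k, j) = 0"
      using ij unip_realD[OF u] unip_realD[OF v] by (cases "k < i") auto
  qed
qed

lemma unip_int_mult:
  assumes "u \<in> unip_int n" "v \<in> unip_int n"
  shows "u * v \<in> unip_int n"
  using unip_real_mult Ints_mult_mat[of u n n v n] assms[THEN unip_intD(1)]
    assms[THEN unip_intD(2)] assms[THEN unip_intD(3)]
  by (simp add: unip_int_def)

lemma SL_int_inverse:
  assumes "g \<in> SL_int n"
  obtains h where "h \<in> carrier_mat n n" "elements_mat h \<subseteq> \<int>" "g * h = 1\<^sub>m n" "h * g = 1\<^sub>m n"
proof
  have g: "g \<in> carrier_mat n n" "elements_mat g \<subseteq> \<int>" "det g = 1"
    using assms by (auto simp: SL_int_def)
  have one: "1 \<cdot>\<^sub>m 1\<^sub>m n = (1\<^sub>m n :: real mat)" by (rule eq_matI) auto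
  show "adj_mat g \<in> carrier_mat n n" "g * adj_mat g = 1\<^sub>m n" "adj_mat g * g = 1\<^sub>m n"
    using adj_mat[OF g(1)] g(3) one by simp_all
  show "elements_mat (adj_mat g) \<subseteq> \<int>" using g by (intro Ints_adj_mat)
qed

text \<open>The inverse is again the adjugate. Integrality is a conditional conclusion so that one
  witness serves both the real and the integral group.\<close>

lemma unip_real_inverse:
  assumes u: "u \<in> unip_real n"
  obtains w where "w \<in> unip_real n" "u * w = 1\<^sub>m n" "w * u = 1\<^sub>m n"
    "elements_mat u \<subseteq> \<int> \<Longrightarrow> elements_mat w \<subseteq> \<int>"
proof
  note uc = unip_realD(1)[OF u]
  let ?w = "adj_mat u"
  note wc = adj_mat(1)[OF uc]
  have one: "1 \<cdot>\<^sub>m 1\<^sub>m n = (1\<^sub>m n :: real mat)" by (rule eq_matI) auto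
  show uw: "u * ?w = 1\<^sub>m n" and wu: "?w * u = 1\<^sub>m n"
    using adj_mat(2,3)[OF uc] det_unip_real[OF u] one by simp_all
  show "elements_mat u \<subseteq> \<int> \<Longrightarrow> elements_mat ?w \<subseteq> \<int>"
    by (rule Ints_adj_mat[OF uc])
  \<comment> \<open>Row \<open>i\<close> of \<open>?w * u = 1\<close> is read from left to right. In
    a column \<open>j \<le> i\<close> the terms with \<open>k < j\<close> vanish by induction and
    those with \<open>k > j\<close> because \<open>u\<close> is upper triangular, which leaves
    \<open>?w $$ (i, j)\<close>.\<close>
  have low: "?w $$ (i, j) = (1\<^sub>m n :: real mat) $$ (i, j)" if "i < n" "j \<le> i" for i j
    using that(2)
  proof (induction j rule: less_induct)
    case (less j)
    have j: "j < n" using less.prems that by simp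
    have "(1\<^sub>m n :: real mat) $$ (i, j) = (\<Sum>k<n. ?w $$ (i, k) * u $$ (k, j))"
      unfolding wu[symmetric] by (rule mult_mat_index[OF wc uc that(1) j])
    also have "\<dots> = (\<Sum>k<n. if k = j then ?w $$ (i, j) else 0)"
    proof (rule sum.cong[OF refl])
      fix k assume k: "k \<in> {..<n}"
      show "?w $$ (i, k) * u $$ (k, j) = (if k = j then ?w $$ (i, j) else 0)"
      proof (cases k j rule: linorder_cases)
        case less': less
        then show ?thesis using less.IH[OF less'] less.prems k that by simp
      qed (use k j unip_realD[OF u] in auto)
    qed
    also have "\<dots> = ?w $$ (i, j)" using j by simp
    finally show ?case by simp
  qed
  show "?w \<in> unip_real n"
    by (rule unip_realI[OF wc]) (use low in auto)
qed

lemma unip_int_inverse: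
  assumes u: "u \<in> unip_int n"
  obtains w where "w \<in> unip_int n" "u * w = 1\<^sub>m n" "w * u = 1\<^sub>m n"
proof -
  obtain w where "w \<in> unip_real n" "u * w = 1\<^sub>m n" "w * u = 1\<^sub>m n"
    "elements_mat u \<subseteq> \<int> \<Longrightarrow> elements_mat w \<subseteq> \<int>"
    using unip_real_inverse[OF unip_intD(1)[OF u]] by blast
  then show ?thesis using unip_intD(3)[OF u] that[of w] by (simp add: unip_int_def)
qed

section \<open>Characters of the unipotent group\<close>

lemma e_unit_add: "e_unit (x + y) = e_unit x * e_unit y"
  by (simp add: e_unit_def distrib_left exp_add)

lemma e_unit_Ints:
  assumes "x \<in> \<int>"
  shows "e_unit (of_real x) = 1"
  using cis_multiple_2pi[OF assms] by (simp add: e_unit_def cis_conv_exp mult_ac)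

text \<open>Superdiagonal entries add under multiplication: row \<open>i\<close> of \<open>u\<close>
  starts at column \<open>i\<close> and column \<open>i + 1\<close> of \<open>v\<close> ends at row
  \<open>i + 1\<close>, so only the summands \<open>k = i\<close> and \<open>k = i + 1\<close>
  survive.\<close>

lemma psi_mult:
  assumes u: "u \<in> unip_real n" and v: "v \<in> unip_real n"
  shows "psi n N (u * v) = psi n N u * psi n N v"
proof -
  note uc = unip_realD(1)[OF u] and vc = unip_realD(1)[OF v]
  have "(u * v) $$ (i, Suc i) = u $$ (i, Suc i) + v $$ (i, Suc i)" if "i < n - 1" for i
  proof -
    have i: "i < n" "Suc i < n" using that by auto
    have "(u * v) $$ (i, Suc i) = (\<Sum>k<n. u $$ (i, k) * v $$ (k, Suc i))"
      by (rule mult_mat_index[OF uc vc i])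
    also have "\<dots> = (\<Sum>k\<in>{i, Suc i}. u $$ (i, k) * v $$ (k, Suc i))"
    proof (rule sum.mono_neutral_right)
      show "\<forall>k\<in>{..<n} - {i, Suc i}. u $$ (i, k) * v $$ (k, Suc i) = 0"
      proof
        fix k assume k: "k \<in> {..<n} - {i, Suc i}"
        then consider "k < i" | "Suc i < k" by force
        then show "u $$ (i, k) * v $$ (k, Suc i) = 0"
          using k i unip_realD(3)[OF u] unip_realD(3)[OF v] by cases auto
      qed
    qed (use i in auto)
    also have "\<dots> = u $$ (i, Suc i) + v $$ (i, Suc i)"
      using i unip_realD(2)[OF u] unip_realD(2)[OF v] by simp
    finally show ?thesis .
  qed
  then have "(\<Sum>i<n-1. of_int (N ! i) * (u * v) $$ (i, Suc i)) =
      (\<Sum>i<n-1. of_int (N ! i) * u $$ (i, Suc i)) + (\<Sum>i<n-1. of_int (N ! i) * v $$ (i, Suc i))"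
    by (simp add: sum.distrib[symmetric] distrib_left del: index_mult_mat)
  then show ?thesis
    unfolding psi_def by (simp add: e_unit_add del: index_mult_mat)
qed

lemma psi_unip_int:
  assumes u: "u \<in> unip_int n"
  shows "psi n N u = 1"
  unfolding psi_def
  using unip_intD(3)[OF u] unfolding elements_mat_subset_iff[OF unip_intD(2)[OF u]]
  by (intro e_unit_Ints Ints_sum Ints_mult) auto

section \<open>Double cosets and Bruhat factors\<close>

lemma dbl_coset_refl:
  assumes "g \<in> carrier_mat n n"
  shows "g \<in> dbl_coset n g"
  unfolding dbl_coset_def
  using assms one_in_unip_int[of n] by (intro CollectI exI[of _ "1\<^sub>m n"]) auto

lemma dbl_coset_trans:
  assumes g: "g \<in> carrier_mat n n" and h: "h \<in> dbl_coset n g"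
  shows "dbl_coset n h \<subseteq> dbl_coset n g"
proof
  obtain u v where u: "u \<in> unip_int n" and v: "v \<in> unip_int n" and h': "h = u * g * v"
    using h by (auto simp: dbl_coset_def)
  fix k assume "k \<in> dbl_coset n h"
  then obtain u' v' where u': "u' \<in> unip_int n" and v': "v' \<in> unip_int n"
    and k: "k = u' * h * v'"
    by (auto simp: dbl_coset_def)
  have "k = (u' * u) * g * (v * v')"
    unfolding k h'
    using g u[THEN unip_intD(2)] v[THEN unip_intD(2)] u'[THEN unip_intD(2)] v'[THEN unip_intD(2)]
    by (simp add: assoc_mult_mat[of _ n n _ n _ n])
  then show "k \<in> dbl_coset n g"
    unfolding dbl_coset_def using unip_int_mult u u' v v' by blast
qed

lemma dbl_coset_sym:
  assumes g: "g \<in> carrier_mat n n" and h: "h \<in> dbl_coset n g"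
  shows "g \<in> dbl_coset n h"
proof -
  obtain u v where u: "u \<in> unip_int n" and v: "v \<in> unip_int n" and h': "h = u * g * v"
    using h by (auto simp: dbl_coset_def)
  obtain u' where u': "u' \<in> unip_int n" "u' * u = 1\<^sub>m n" using unip_int_inverse[OF u] by metis
  obtain v' where v': "v' \<in> unip_int n" "v * v' = 1\<^sub>m n" using unip_int_inverse[OF v] by metis
  note c = g u[THEN unip_intD(2)] v[THEN unip_intD(2)] u'(1)[THEN unip_intD(2)] v'(1)[THEN unip_intD(2)]
  have "u' * h * v' = (u' * u) * g * (v * v')"
    unfolding h' using c by (simp add: assoc_mult_mat[of _ n n _ n _ n])
  also have "\<dots> = g" using c u'(2) v'(2) by simp
  finally show ?thesis
    unfolding dbl_coset_def using u'(1) v'(1) by (intro CollectI exI[of _ u'] exI[of _ v']) auto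
qed

text \<open>Since \<open>unip_int n\<close> is a group, lying in a double coset is an equivalence
  relation: products give transitivity, inverses give symmetry.\<close>

lemma dbl_coset_eq:
  assumes "g \<in> carrier_mat n n" and "h \<in> dbl_coset n g"
  shows "dbl_coset n h = dbl_coset n g"
proof
  show "dbl_coset n h \<subseteq> dbl_coset n g" using assms by (rule dbl_coset_trans)
  have "h \<in> carrier_mat n n"
    using assms by (auto simp: dbl_coset_def dest!: unip_intD(2))
  then show "dbl_coset n g \<subseteq> dbl_coset n h"
    using dbl_coset_trans dbl_coset_sym[OF assms] by blast
qed

section \<open>The Bruhat decomposition and its uniqueness\<close>

definition cw_mat :: "nat \<Rightarrow> nat list \<Rightarrow> real mat" where
  "cw_mat n D = c_mat n D * long_weyl n"

lemma c_mat_carrier: "c_mat n D \<in> carrier_mat n n"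
  by (simp add: c_mat_def)

lemma long_weyl_carrier: "long_weyl n \<in> carrier_mat n n"
  by (simp add: long_weyl_def)

lemma cw_mat_carrier: "cw_mat n D \<in> carrier_mat n n"
  using mult_carrier_mat[OF c_mat_carrier long_weyl_carrier] by (simp add: cw_mat_def)

text \<open>The diagonal matrix \<open>c\<close> scales the rows of the antidiagonal matrix
  \<open>w_0\<close>. The product is again antidiagonal, so entries of a product with it collapse to
  a single term.\<close>

lemma cw_mat_index:
  assumes "i < n" "j < n"
  shows "cw_mat n D $$ (i, j) = (if i + j + 1 = n
    then real (D_ext n D (n - i)) / real (D_ext n D (n - i - 1)) * (-1) ^ j else 0)"
  unfolding cw_mat_def c_mat_def mat_diag_mult_left[OF long_weyl_carrier]
  using assms by (simp add: long_weyl_def)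

lemma cw_mat_fold:
  assumes "b \<in> carrier_mat n n"
  shows "b * c_mat n D * long_weyl n = b * cw_mat n D"
  unfolding cw_mat_def using assms c_mat_carrier long_weyl_carrier
  by (intro assoc_mult_mat[of _ n n _ n _ n])

lemma D_ext_pos:
  assumes "\<forall>d \<in> set D. d > 0" "length D = n - 1" "k \<le> n"
  shows "D_ext n D k > 0"
  using assms by (auto simp: D_ext_def)

text \<open>Conjugation by \<open>c w\<^sub>0\<close> turns upper into lower triangular matrices, and only the identity
  is both upper and lower unipotent.\<close>

lemma cw_mat_commute_unip:
  assumes pos: "\<forall>k\<le>n. D_ext n D k > 0"
    and u: "u \<in> unip_real n" and v: "v \<in> unip_real n"
    and eq: "u * cw_mat n D = cw_mat n D * v"
  shows "u = 1\<^sub>m n" "v = 1\<^sub>m n"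
proof -
  let ?W = "cw_mat n D"
  note uc = unip_realD(1)[OF u] and vc = unip_realD(1)[OF v] and wc = cw_mat_carrier[of n D]
  define a where "a i = ?W $$ (i, n - 1 - i)" for i
  have nz: "a i \<noteq> 0" if "i < n" for i
    using pos that by (simp add: a_def cw_mat_index)
  \<comment> \<open>Both sides of \<open>eq\<close> are read at position
    \<open>(i, n - 1 - k)\<close>, where antidiagonality leaves one term each. The reflection
    \<open>i \<mapsto> n - 1 - i\<close> reverses the order of the indices, so the zeros of
    \<open>v\<close> below the diagonal become zeros of \<open>u\<close> above it, and those of
    \<open>u\<close> below become zeros of \<open>v\<close> above.\<close>
  have key: "u $$ (i, k) * a k = a i * v $$ (n - 1 - i, n - 1 - k)" if i: "i < n" and k: "k < n" for i k
  proof -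
    have k': "n - 1 - k < n" using k by simp
    have "(u * ?W) $$ (i, n - 1 - k) = (\<Sum>l<n. u $$ (i, l) * ?W $$ (l, n - 1 - k))"
      by (rule mult_mat_index[OF uc wc i k'])
    also have "\<dots> = (\<Sum>l<n. if l = k then u $$ (i, k) * a k else 0)"
      using k by (intro sum.cong[OF refl]) (auto simp: cw_mat_index a_def)
    also have "\<dots> = u $$ (i, k) * a k" using k by simp
    finally have l: "(u * ?W) $$ (i, n - 1 - k) = u $$ (i, k) * a k" .
    have "(?W * v) $$ (i, n - 1 - k) = (\<Sum>l<n. ?W $$ (i, l) * v $$ (l, n - 1 - k))"
      by (rule mult_mat_index[OF wc vc i k'])
    also have "\<dots> = (\<Sum>l<n. if l = n - 1 - i then a i * v $$ (n - 1 - i, n - 1 - k) else 0)"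
      using i by (intro sum.cong[OF refl]) (auto simp: cw_mat_index a_def)
    also have "\<dots> = a i * v $$ (n - 1 - i, n - 1 - k)" using i by simp
    finally show ?thesis using l eq by simp
  qed
  have u0: "u $$ (i, k) = 0" if "i < k" "k < n" for i k
    using key[of i k] nz[of k] that unip_realD(3)[OF v, of "n - 1 - k" "n - 1 - i"] by simp
  show "u = 1\<^sub>m n"
  proof (rule eq_matI)
    fix i j assume "i < dim_row (1\<^sub>m n :: real mat)" "j < dim_col (1\<^sub>m n :: real mat)"
    then show "u $$ (i, j) = 1\<^sub>m n $$ (i, j)"
      using u0 unip_realD(2,3)[OF u] by (cases i j rule: linorder_cases) auto
  qed (use uc in auto)
  have v0: "v $$ (i, k) = 0" if "i < k" "k < n" for i k
  proof -
    have "u $$ (n - 1 - i, n - 1 - k) = 0"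
      using that by (intro unip_realD(3)[OF u]) auto
    then show ?thesis using key[of "n - 1 - i" "n - 1 - k"] nz[of "n - 1 - i"] that by simp
  qed
  show "v = 1\<^sub>m n"
  proof (rule eq_matI)
    fix i j assume "i < dim_row (1\<^sub>m n :: real mat)" "j < dim_col (1\<^sub>m n :: real mat)"
    then show "v $$ (i, j) = 1\<^sub>m n $$ (i, j)"
      using v0 unip_realD(2,3)[OF v] by (cases i j rule: linorder_cases) auto
  qed (use vc in auto)
qed

text \<open>With \<open>p\<close> the inverse of \<open>b1'\<close> and \<open>q\<close> the inverse
  of \<open>b2\<close>, the equation becomes \<open>p * b1 * W = W * (b2' * q)\<close> for
  \<open>W = cw_mat n D\<close>. Both \<open>p * b1\<close> and \<open>b2' * q\<close> are
  unipotent, so \<open>cw_mat_commute_unip\<close> makes them the identity.\<close>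

lemma bruhat_unique:
  assumes pos: "\<forall>k\<le>n. D_ext n D k > 0"
    and b: "b1 \<in> unip_real n" "b2 \<in> unip_real n" "b1' \<in> unip_real n" "b2' \<in> unip_real n"
    and eq: "b1 * cw_mat n D * b2 = b1' * cw_mat n D * b2'"
  shows "b1 = b1'" "b2 = b2'"
proof -
  let ?W = "cw_mat n D"
  obtain p where p: "p \<in> unip_real n" "p * b1' = 1\<^sub>m n" "b1' * p = 1\<^sub>m n"
    using unip_real_inverse[OF b(3)] by metis
  obtain q where q: "q \<in> unip_real n" "b2 * q = 1\<^sub>m n" "q * b2 = 1\<^sub>m n"
    using unip_real_inverse[OF b(2)] by metis
  note c = b[THEN unip_realD(1)] p(1)[THEN unip_realD(1)] q(1)[THEN unip_realD(1)] cw_mat_carrier[of n D]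
  note assoc = assoc_mult_mat[of _ n n _ n _ n]
  have "(p * b1) * ?W = (p * b1) * ?W * (b2 * q)" using c q by simp
  also have "\<dots> = p * (b1 * ?W * b2) * q" using c by (simp add: assoc)
  also have "\<dots> = (p * b1') * ?W * (b2' * q)" unfolding eq using c by (simp add: assoc)
  also have "\<dots> = ?W * (b2' * q)" using c p by simp
  finally have "p * b1 * ?W = ?W * (b2' * q)" .
  then have 1: "p * b1 = 1\<^sub>m n" "b2' * q = 1\<^sub>m n"
    using cw_mat_commute_unip[OF pos unip_real_mult[OF p(1) b(1)] unip_real_mult[OF b(4) q(1)]]
    by simp_all
  have "b1 = (b1' * p) * b1" using c p by simp
  also have "\<dots> = b1' * (p * b1)" using c by (intro assoc)
  also have "\<dots> = b1'" using c 1 by simp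
  finally show "b1 = b1'" .
  have "b2' = b2' * (q * b2)" using c q by simp
  also have "\<dots> = (b2' * q) * b2" using c by (intro assoc[symmetric])
  also have "\<dots> = b2" using c 1 by simp
  finally show "b2 = b2'" by simp
qed

text \<open>Uniqueness gives the definite descriptions in \<open>mu\<close> and \<open>mu'\<close>
  their meaning: any explicit factorisation can be used to evaluate them.\<close>

lemma mu_eq:
  assumes pos: "\<forall>k\<le>n. D_ext n D k > 0"
    and b: "b1 \<in> unip_real n" "b2 \<in> unip_real n"
  shows "mu n D (b1 * cw_mat n D * b2) = b1" "mu' n D (b1 * cw_mat n D * b2) = b2"
proof -
  note fold = cw_mat_fold[OF unip_realD(1)]
  show "mu n D (b1 * cw_mat n D * b2) = b1"
    unfolding mu_def
  proof (rule the_equality)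
    show "b1 \<in> unip_real n \<and> (\<exists>b\<in>unip_real n.
        b1 * cw_mat n D * b2 = b1 * c_mat n D * long_weyl n * b)"
      using b by (intro conjI bexI[of _ b2]) (simp_all add: fold)
    fix a assume "a \<in> unip_real n \<and> (\<exists>b\<in>unip_real n.
        b1 * cw_mat n D * b2 = a * c_mat n D * long_weyl n * b)"
    then obtain b where "a \<in> unip_real n" "b \<in> unip_real n"
      "b1 * cw_mat n D * b2 = a * cw_mat n D * b"
      by (auto simp: fold)
    then show "a = b1" using bruhat_unique(1)[OF pos b] by simp
  qed
  show "mu' n D (b1 * cw_mat n D * b2) = b2"
    unfolding mu'_def
  proof (rule the_equality)
    show "b2 \<in> unip_real n \<and> (\<exists>b\<in>unip_real n.
        b1 * cw_mat n D * b2 = b * c_mat n D * long_weyl n * b2)"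
      using b by (intro conjI bexI[of _ b1]) (simp_all add: fold)
    fix a assume "a \<in> unip_real n \<and> (\<exists>b\<in>unip_real n.
        b1 * cw_mat n D * b2 = b * c_mat n D * long_weyl n * a)"
    then obtain b where "a \<in> unip_real n" "b \<in> unip_real n"
      "b1 * cw_mat n D * b2 = b * cw_mat n D * a"
      by (auto simp: fold)
    then show "a = b2" using bruhat_unique(2)[OF pos b] by simp
  qed
qed

lemma big_cell_iff:
  "g \<in> big_cell n D \<longleftrightarrow>
    g \<in> SL_int n \<and> (\<exists>b1\<in>unip_real n. \<exists>b2\<in>unip_real n. g = b1 * cw_mat n D * b2)"
proof -
  have "(\<exists>b1 b2. g = b1 * c_mat n D * long_weyl n * b2 \<and> b1 \<in> unip_real n \<and> b2 \<in> unip_real n) \<longleftrightarrow>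
      (\<exists>b1 b2. g = b1 * cw_mat n D * b2 \<and> b1 \<in> unip_real n \<and> b2 \<in> unip_real n)"
    by (intro ex_cong1 rev_conj_cong refl) (simp add: cw_mat_fold[OF unip_realD(1)])
  then show ?thesis unfolding big_cell_def Int_iff mem_Collect_eq by blast
qed

section \<open>The summand as a function on double cosets\<close>

definition kl_summand :: "nat \<Rightarrow> int list \<Rightarrow> int list \<Rightarrow> nat list \<Rightarrow> real mat \<Rightarrow> complex" where
  "kl_summand n M N D g = psi n (rev M) (mu n D g) * psi n N (mu' n D g)"

text \<open>The outer integral factors are absorbed into the Bruhat factors, and \<open>psi\<close>
  is multiplicative and trivial on \<open>unip_int n\<close>.\<close>

lemma kl_summand_dbl_coset:
  assumes pos: "\<forall>k\<le>n. D_ext n D k > 0"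
    and g: "g \<in> big_cell n D" and h: "h \<in> dbl_coset n g"
  shows "kl_summand n M N D h = kl_summand n M N D g"
proof -
  obtain b1 b2 where b: "b1 \<in> unip_real n" "b2 \<in> unip_real n" and g': "g = b1 * cw_mat n D * b2"
    using g by (auto simp: big_cell_iff)
  obtain u v where u: "u \<in> unip_int n" and v: "v \<in> unip_int n" and h': "h = u * g * v"
    using h by (auto simp: dbl_coset_def)
  have "h = (u * b1) * cw_mat n D * (b2 * v)"
    unfolding h' g' using b[THEN unip_realD(1)] u[THEN unip_intD(2)] v[THEN unip_intD(2)] cw_mat_carrier[of n D]
    by (simp add: assoc_mult_mat[of _ n n _ n _ n])
  then show ?thesis
    using b u v g' mu_eq[OF pos] unip_intD(1)[OF u] unip_intD(1)[OF v]
    by (simp add: kl_summand_def unip_real_mult psi_mult psi_unip_int)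
qed

text \<open>Trades the arbitrary representative picked by \<open>SOME\<close> for one of known
  shape; later these are bordered matrices.\<close>

lemma kl_summand_some:
  assumes "\<forall>k\<le>n. D_ext n D k > 0" and "g \<in> big_cell n D"
  shows "kl_summand n M N D (SOME h. h \<in> dbl_coset n g) = kl_summand n M N D g"
proof -
  have "g \<in> dbl_coset n g" using assms by (auto simp: big_cell_def SL_int_def intro: dbl_coset_refl)
  then show ?thesis by (intro kl_summand_dbl_coset[OF assms] someI)
qed

lemma kloosterman_alt:
  "kloosterman n M N D = (\<Sum>x\<in>X_set n D. kl_summand n M N D (SOME g. g \<in> x))"
  by (simp add: kloosterman_def kl_summand_def Let_def)

section \<open>Bordering a matrix\<close>

definition lower_left :: "nat \<Rightarrow> 'a mat \<Rightarrow> 'a mat" where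
  "lower_left m g = mat m m (\<lambda>(i, j). g $$ (Suc i, j))"

text \<open>The sign in the corner makes \<open>embed\<close> preserve determinants.\<close>

definition embed :: "nat \<Rightarrow> real mat \<Rightarrow> real mat" where
  "embed m g = four_block_mat (0\<^sub>m 1 m) (mat 1 1 (\<lambda>_. (-1) ^ m)) g (0\<^sub>m m 1)"

text \<open>The row shape is used for left factors and the column shape \<open>unip_col\<close> for
  right factors, because the lower left block of the matrix between them is then multiplied by
  \<open>u\<close> and \<open>v\<close> alone.\<close>

definition unip_row :: "nat \<Rightarrow> real mat \<Rightarrow> real mat \<Rightarrow> real mat" where
  "unip_row m x u = four_block_mat (1\<^sub>m 1) x (0\<^sub>m m 1) u"

definition unip_col :: "nat \<Rightarrow> real mat \<Rightarrow> real mat \<Rightarrow> real mat" where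
  "unip_col m v y = four_block_mat v y (0\<^sub>m 1 m) (1\<^sub>m 1)"

lemma lower_left_carrier: "lower_left m g \<in> carrier_mat m m"
  by (simp add: lower_left_def)

lemma embed_carrier:
  assumes "g \<in> carrier_mat m m"
  shows "embed m g \<in> carrier_mat (Suc m) (Suc m)"
  using assms by (auto simp: embed_def)

lemma lower_left_embed:
  assumes "g \<in> carrier_mat m m"
  shows "lower_left m (embed m g) = g"
  using assms by (intro eq_matI) (auto simp: lower_left_def embed_def)

lemma unip_row_in_unip_real:
  assumes "x \<in> carrier_mat 1 m" "u \<in> unip_real m"
  shows "unip_row m x u \<in> unip_real (Suc m)"
  using assms unip_realD[OF assms(2)] by (intro unip_realI) (auto simp: unip_row_def)

lemma unip_col_in_unip_real:
  assumes "v \<in> unip_real m" "y \<in> carrier_mat m 1"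
  shows "unip_col m v y \<in> unip_real (Suc m)"
  using assms unip_realD[OF assms(1)] less_antisym
  by (intro unip_realI) (auto simp: unip_col_def)

lemma unip_row_in_unip_int_iff:
  assumes x: "x \<in> carrier_mat 1 m" and u: "u \<in> unip_real m"
  shows "unip_row m x u \<in> unip_int (Suc m) \<longleftrightarrow> elements_mat x \<subseteq> \<int> \<and> u \<in> unip_int m"
proof -
  note uc = unip_realD(1)[OF u] and rc = unip_realD(1)[OF unip_row_in_unip_real[OF x u]]
  have "elements_mat (unip_row m x u) \<subseteq> \<int> \<longleftrightarrow> elements_mat x \<subseteq> \<int> \<and> elements_mat u \<subseteq> \<int>"
    unfolding elements_mat_subset_iff[OF rc] elements_mat_subset_iff[OF uc]
      elements_mat_subset_iff[OF x]
    using x uc by (simp add: unip_row_def All_less_Suc2)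
  then show ?thesis using u unip_row_in_unip_real[OF x u] by (auto simp: unip_int_def)
qed

lemma unip_col_in_unip_int_iff:
  assumes v: "v \<in> unip_real m" and y: "y \<in> carrier_mat m 1"
  shows "unip_col m v y \<in> unip_int (Suc m) \<longleftrightarrow> v \<in> unip_int m \<and> elements_mat y \<subseteq> \<int>"
proof -
  note vc = unip_realD(1)[OF v] and cc = unip_realD(1)[OF unip_col_in_unip_real[OF v y]]
  have "elements_mat (unip_col m v y) \<subseteq> \<int> \<longleftrightarrow> elements_mat v \<subseteq> \<int> \<and> elements_mat y \<subseteq> \<int>"
    unfolding elements_mat_subset_iff[OF cc] elements_mat_subset_iff[OF vc]
      elements_mat_subset_iff[OF y]
    using y vc by (auto simp: unip_col_def All_less_Suc)
  then show ?thesis using v unip_col_in_unip_real[OF v y] by (auto simp: unip_int_def)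
qed

lemma unip_row_zero_in_unip_int:
  assumes "u \<in> unip_int m"
  shows "unip_row m (0\<^sub>m 1 m) u \<in> unip_int (Suc m)"
  using unip_row_in_unip_int_iff[of "0\<^sub>m 1 m" m u] unip_intD(1)[OF assms] assms
    elements_mat_subset_iff[of "0\<^sub>m 1 m :: real mat" 1 m \<int>] by auto

lemma unip_col_zero_in_unip_int:
  assumes "v \<in> unip_int m"
  shows "unip_col m v (0\<^sub>m m 1) \<in> unip_int (Suc m)"
  using unip_col_in_unip_int_iff[of v m "0\<^sub>m m 1"] unip_intD(1)[OF assms] assms
    elements_mat_subset_iff[of "0\<^sub>m m 1 :: real mat" m 1 \<int>] by auto

section \<open>Block decompositions and unipotent operations on blocks\<close>

lemma unip_real_rowE:
  assumes u: "u \<in> unip_real (Suc m)"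
  obtains x u' where "x \<in> carrier_mat 1 m" "u' \<in> unip_real m" "u = unip_row m x u'"
proof
  note D = unip_realD[OF u]
  let ?x = "mat 1 m (\<lambda>(i, j). u $$ (0, Suc j))"
  let ?u = "mat m m (\<lambda>(i, j). u $$ (Suc i, Suc j))"
  show "?x \<in> carrier_mat 1 m" by simp
  show "?u \<in> unip_real m" using D by (intro unip_realI) auto
  show "u = unip_row m ?x ?u"
  proof (rule eq_matI)
    fix i j assume "i < dim_row (unip_row m ?x ?u)" "j < dim_col (unip_row m ?x ?u)"
    then show "u $$ (i, j) = unip_row m ?x ?u $$ (i, j)"
      using D by (cases i; cases j) (auto simp: unip_row_def)
  qed (use D in \<open>auto simp: unip_row_def\<close>)
qed

lemma unip_real_colE:
  assumes v: "v \<in> unip_real (Suc m)"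
  obtains v' y where "v' \<in> unip_real m" "y \<in> carrier_mat m 1" "v = unip_col m v' y"
proof
  note D = unip_realD[OF v]
  let ?y = "mat m 1 (\<lambda>(i, j). v $$ (i, m))"
  let ?v = "mat m m (\<lambda>(i, j). v $$ (i, j))"
  show "?y \<in> carrier_mat m 1" by simp
  show "?v \<in> unip_real m" using D by (intro unip_realI) auto
  show "v = unip_col m ?v ?y"
  proof (rule eq_matI)
    fix i j assume "i < dim_row (unip_col m ?v ?y)" "j < dim_col (unip_col m ?v ?y)"
    then have "i < m \<or> i = m" "j < m \<or> j = m" by (auto simp: unip_col_def)
    then show "v $$ (i, j) = unip_col m ?v ?y $$ (i, j)"
      using D by (auto simp: unip_col_def)
  qed (use D in \<open>auto simp: unip_col_def\<close>)
qed

text \<open>The bounds on \<open>elements_mat\<close> pass integrality from \<open>g\<close> to the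
  two borders that are to be cleared.\<close>

lemma four_block_lower_left:
  assumes g: "g \<in> carrier_mat (Suc m) (Suc m)"
  obtains a b s where "a \<in> carrier_mat 1 m" "b \<in> carrier_mat 1 1" "s \<in> carrier_mat m 1"
    "g = four_block_mat a b (lower_left m g) s"
    "elements_mat a \<subseteq> elements_mat g" "elements_mat s \<subseteq> elements_mat g"
proof
  let ?a = "mat 1 m (\<lambda>(i, j). g $$ (0, j))" and ?b = "mat 1 1 (\<lambda>(i, j). g $$ (0, m))"
  let ?s = "mat m 1 (\<lambda>(i, j). g $$ (Suc i, m))"
  show a: "?a \<in> carrier_mat 1 m" and "?b \<in> carrier_mat 1 1" and s: "?s \<in> carrier_mat m 1"
    by auto
  show "g = four_block_mat ?a ?b (lower_left m g) ?s" (is "g = ?f")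
  proof (rule eq_matI)
    fix i j assume "i < dim_row ?f" "j < dim_col ?f"
    then have "i = 0 \<or> (\<exists>k<m. i = Suc k)" "j < m \<or> j = m"
      by (auto simp: lower_left_def less_Suc_eq_0_disj)
    then show "g $$ (i, j) = ?f $$ (i, j)"
      by (auto simp: lower_left_def)
  qed (use g in \<open>auto simp: lower_left_def\<close>)
  show "elements_mat ?a \<subseteq> elements_mat g" "elements_mat ?s \<subseteq> elements_mat g"
    unfolding elements_mat_subset_iff[OF a] elements_mat_subset_iff[OF s]
    by (auto intro: elements_matI[OF g _ _ refl])
qed

lemma lower_left_four_block:
  assumes "a \<in> carrier_mat 1 m" "b \<in> carrier_mat 1 1" "h \<in> carrier_mat m m" "s \<in> carrier_mat m 1"
  shows "lower_left m (four_block_mat a b h s) = h"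
  using assms by (intro eq_matI) (auto simp: lower_left_def)

text \<open>The block identity behind the reduction: the lower left block becomes
  \<open>u * h * v\<close>, while \<open>x\<close> and \<open>y\<close> affect only the first row
  and the last column and are free to be used for elimination there.\<close>

lemma unip_row_four_block_unip_col:
  assumes c: "a \<in> carrier_mat 1 m" "b \<in> carrier_mat 1 1" "h \<in> carrier_mat m m" "s \<in> carrier_mat m 1"
    and x: "x \<in> carrier_mat 1 m" "u \<in> carrier_mat m m"
    and y: "y \<in> carrier_mat m 1" "v \<in> carrier_mat m m"
  shows "unip_row m x u * four_block_mat a b h s * unip_col m v y =
    four_block_mat ((a + x * h) * v) ((a + x * h) * y + (b + x * s)) (u * h * v) (u * h * y + u * s)"
proof -
  have "unip_row m x u * four_block_mat a b h s = four_block_mat (a + x * h) (b + x * s) (u * h) (u * s)"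
    unfolding unip_row_def
    by (subst mult_four_block_mat[of _ 1 1 _ m _ m _ _ m _ 1]) (use c x in auto)
  then show ?thesis
    unfolding unip_col_def
    by (simp only:, subst mult_four_block_mat[of _ 1 m _ 1 _ m _ _ m _ 1]) (use c x y in auto)
qed

lemma lower_left_mult:
  assumes g: "g \<in> carrier_mat (Suc m) (Suc m)"
    and x: "x \<in> carrier_mat 1 m" "u \<in> carrier_mat m m"
    and y: "y \<in> carrier_mat m 1" "v \<in> carrier_mat m m"
  shows "lower_left m (unip_row m x u * g * unip_col m v y) = u * lower_left m g * v"
proof -
  obtain a b s where c: "a \<in> carrier_mat 1 m" "b \<in> carrier_mat 1 1" "s \<in> carrier_mat m 1"
    and g': "g = four_block_mat a b (lower_left m g) s"
    by (rule four_block_lower_left[OF g])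
  define h where "h = lower_left m g"
  have h: "h \<in> carrier_mat m m" by (simp add: h_def lower_left_carrier)
  have "unip_row m x u * g * unip_col m v y =
      unip_row m x u * four_block_mat a b h s * unip_col m v y"
    using g' unfolding h_def by (rule arg_cong)
  also have "\<dots> = four_block_mat ((a + x * h) * v) ((a + x * h) * y + (b + x * s))
      (u * h * v) (u * h * y + u * s)"
    by (rule unip_row_four_block_unip_col[OF c(1,2) h c(3) x y])
  also have "lower_left m \<dots> = u * h * v"
    by (rule lower_left_four_block) (use c h x y in auto)
  finally show ?thesis unfolding h_def .
qed

lemma embed_mult:
  assumes "h \<in> carrier_mat m m" "u \<in> carrier_mat m m" "v \<in> carrier_mat m m"
  shows "embed m (u * h * v) = unip_row m (0\<^sub>m 1 m) u * embed m h * unip_col m v (0\<^sub>m m 1)"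
  unfolding embed_def
  by (subst unip_row_four_block_unip_col) (use assms in auto)

text \<open>Laplace expansion along the first row, where only column \<open>m\<close> can
  contribute; its cofactor carries the sign \<open>(-1) ^ m\<close>.\<close>

lemma det_four_block_corner:
  assumes b: "b \<in> carrier_mat 1 1" and h: "h \<in> carrier_mat m m"
  shows "det (four_block_mat (0\<^sub>m 1 m) b h (0\<^sub>m m 1)) = b $$ (0, 0) * (-1) ^ m * det (h :: real mat)"
    (is "det ?g = _")
proof -
  have g: "?g \<in> carrier_mat (Suc m) (Suc m)" using b h by auto
  have "mat_delete ?g 0 m = h"
    using b h by (intro eq_matI) (auto simp: mat_delete_def)
  then have cof: "cofactor ?g 0 m = (-1) ^ m * det h" by (simp add: cofactor_def)
  have "det ?g = (\<Sum>j<Suc m. ?g $$ (0, j) * cofactor ?g 0 j)"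
    by (rule laplace_expansion_row[OF g]) simp
  also have "\<dots> = ?g $$ (0, m) * cofactor ?g 0 m"
    using b h by (simp add: lessThan_Suc)
  finally show ?thesis using b h cof by simp
qed

lemma det_embed:
  assumes "h \<in> carrier_mat m m"
  shows "det (embed m h) = det h"
  unfolding embed_def by (subst det_four_block_corner) (use assms in auto)

lemma embed_in_SL_int:
  assumes h: "h \<in> SL_int m"
  shows "embed m h \<in> SL_int (Suc m)"
proof -
  have hc: "h \<in> carrier_mat m m" using h by (simp add: SL_int_def)
  have "elements_mat (embed m h) \<subseteq> \<int>"
    using h hc unfolding elements_mat_subset_iff[OF embed_carrier[OF hc]] SL_int_def
    by (auto simp: embed_def elements_mat_subset_iff[OF hc])
  then show ?thesis using h det_embed[OF hc] embed_carrier[OF hc] by (simp add: SL_int_def)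
qed

text \<open>Elimination over the integers: the inverse of the lower left block is integral, so both
  borders can be cleared by factors from \<open>unip_int\<close>, and the determinant then forces
  the corner.\<close>

lemma embed_lower_left_in_dbl_coset:
  assumes g: "g \<in> SL_int (Suc m)" and h: "lower_left m g \<in> SL_int m"
  shows "embed m (lower_left m g) \<in> dbl_coset (Suc m) g"
proof -
  let ?h = "lower_left m g"
  have gc: "g \<in> carrier_mat (Suc m) (Suc m)" and gZ: "elements_mat g \<subseteq> \<int>" and gd: "det g = 1"
    using g by (auto simp: SL_int_def)
  have hc: "?h \<in> carrier_mat m m" by (rule lower_left_carrier)
  obtain a b s where c: "a \<in> carrier_mat 1 m" "b \<in> carrier_mat 1 1" "s \<in> carrier_mat m 1"
    and g': "g = four_block_mat a b ?h s"
    and as: "elements_mat a \<subseteq> elements_mat g" "elements_mat s \<subseteq> elements_mat g"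
    by (rule four_block_lower_left[OF gc])
  have aZ: "elements_mat a \<subseteq> \<int>" and sZ: "elements_mat s \<subseteq> \<int>"
    using as gZ by auto
  obtain k where k: "k \<in> carrier_mat m m" "elements_mat k \<subseteq> \<int>" "?h * k = 1\<^sub>m m" "k * ?h = 1\<^sub>m m"
    using SL_int_inverse[OF h] by metis
  \<comment> \<open>With \<open>k\<close> the inverse of the block \<open>?h\<close>, these choices
    solve \<open>a + x * ?h = 0\<close> and \<open>?h * y + s = 0\<close>.\<close>
  define x where "x = (- a) * k"
  define y where "y = k * (- s)"
  have xc: "x \<in> carrier_mat 1 m" and yc: "y \<in> carrier_mat m 1"
    using c k by (auto simp: x_def y_def)
  have maZ: "elements_mat (- a) \<subseteq> \<int>"
    using aZ c elements_mat_subset_iff[OF c(1)] by (subst elements_mat_subset_iff[of _ 1 m]) auto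
  have msZ: "elements_mat (- s) \<subseteq> \<int>"
    using sZ c elements_mat_subset_iff[OF c(3)] by (subst elements_mat_subset_iff[of _ m 1]) auto
  have xZ: "elements_mat x \<subseteq> \<int>"
    unfolding x_def by (rule Ints_mult_mat[of _ 1 m _ m]) (use c k maZ in auto)
  have yZ: "elements_mat y \<subseteq> \<int>"
    unfolding y_def by (rule Ints_mult_mat[of _ m m _ 1]) (use c k msZ in auto)
  have "x * ?h = (- a) * (k * ?h)"
    unfolding x_def by (rule assoc_mult_mat) (use c k hc in auto)
  then have xh: "a + x * ?h = 0\<^sub>m 1 m" using c k by (auto intro!: eq_matI)
  have "?h * y = (?h * k) * (- s)"
    unfolding y_def by (rule assoc_mult_mat[symmetric]) (use c k hc in auto)
  then have hy: "?h * y + s = 0\<^sub>m m 1" using c k by (auto intro!: eq_matI)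
  let ?U = "unip_row m x (1\<^sub>m m)" and ?V = "unip_col m (1\<^sub>m m) y"
  \<comment> \<open>As \<open>a + x * ?h\<close> vanishes, the corner of the product loses its term
    in \<open>y\<close> and reduces to \<open>b + x * s\<close>.\<close>
  define t where "t = b + x * s"
  have t: "t \<in> carrier_mat 1 1" using c xc by (auto simp: t_def)
  have U: "?U \<in> unip_int (Suc m)" and V: "?V \<in> unip_int (Suc m)"
    using unip_row_in_unip_int_iff[OF xc one_in_unip_real] xZ
      unip_col_in_unip_int_iff[OF one_in_unip_real yc] yZ one_in_unip_int by auto
  have "?U * g * ?V = four_block_mat ((a + x * ?h) * 1\<^sub>m m) ((a + x * ?h) * y + t)
      (1\<^sub>m m * ?h * 1\<^sub>m m) (1\<^sub>m m * ?h * y + 1\<^sub>m m * s)"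
    unfolding t_def
    using arg_cong[OF g', of "\<lambda>z. ?U * z * ?V"]
      unip_row_four_block_unip_col[OF c(1,2) hc c(3) xc one_carrier_mat yc one_carrier_mat]
    by (rule trans)
  also have "\<dots> = four_block_mat (0\<^sub>m 1 m) t ?h (0\<^sub>m m 1)"
    using c hc xc yc t hy by (simp add: xh)
  finally have eq: "?U * g * ?V = four_block_mat (0\<^sub>m 1 m) t ?h (0\<^sub>m m 1)" .
  have "det (?U * g * ?V) = 1"
    using gc gd U[THEN unip_intD(2)] V[THEN unip_intD(2)]
      det_unip_real[OF unip_intD(1)[OF U]] det_unip_real[OF unip_intD(1)[OF V]]
    by (simp add: det_mult[of _ "Suc m"])
  \<comment> \<open>The block has determinant 1, so the corner is the inverse of
    \<open>(-1) ^ m\<close>, which is \<open>(-1) ^ m\<close> itself.\<close>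
  then have "t $$ (0, 0) * (-1) ^ m = 1"
    unfolding eq det_four_block_corner[OF t hc] using h by (simp add: SL_int_def)
  then have "t $$ (0, 0) = (-1) ^ m"
    by (cases "even m") auto
  then have "t = mat 1 1 (\<lambda>_. (-1) ^ m)" using t by (intro eq_matI) auto
  then have "?U * g * ?V = embed m ?h" unfolding eq embed_def by simp
  then show ?thesis unfolding dbl_coset_def using U V by (metis (mono_tags, lifting) mem_Collect_eq)
qed

text \<open>For one inclusion the integral factors are split into their block shapes; for the other,
  integral factors of size \<open>m\<close> are lifted with a zero border. Block extraction is
  thereby well defined on double cosets.\<close>

lemma lower_left_dbl_coset:
  assumes g: "g \<in> carrier_mat (Suc m) (Suc m)"
  shows "lower_left m ` dbl_coset (Suc m) g = dbl_coset m (lower_left m g)"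
proof (intro equalityI subsetI)
  fix h assume "h \<in> lower_left m ` dbl_coset (Suc m) g"
  then obtain u v where u: "u \<in> unip_int (Suc m)" and v: "v \<in> unip_int (Suc m)"
    and h: "h = lower_left m (u * g * v)"
    by (auto simp: dbl_coset_def)
  obtain x u' where x: "x \<in> carrier_mat 1 m" "u' \<in> unip_real m" "u = unip_row m x u'"
    using unip_real_rowE[OF unip_intD(1)[OF u]] by metis
  obtain v' y where y: "v' \<in> unip_real m" "y \<in> carrier_mat m 1" "v = unip_col m v' y"
    using unip_real_colE[OF unip_intD(1)[OF v]] by metis
  have "h = u' * lower_left m g * v'"
    unfolding h x(3) y(3)
    by (rule lower_left_mult[OF g x(1) unip_realD(1)[OF x(2)] y(2) unip_realD(1)[OF y(1)]])
  moreover have "u' \<in> unip_int m" "v' \<in> unip_int m"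
    using u v x y unip_row_in_unip_int_iff unip_col_in_unip_int_iff by auto
  ultimately show "h \<in> dbl_coset m (lower_left m g)" unfolding dbl_coset_def by blast
next
  fix h assume "h \<in> dbl_coset m (lower_left m g)"
  then obtain u v where u: "u \<in> unip_int m" and v: "v \<in> unip_int m"
    and h: "h = u * lower_left m g * v"
    by (auto simp: dbl_coset_def)
  let ?U = "unip_row m (0\<^sub>m 1 m) u" and ?V = "unip_col m v (0\<^sub>m m 1)"
  have "h = lower_left m (?U * g * ?V)"
    unfolding h by (rule lower_left_mult[symmetric]) (use g u v in \<open>auto dest: unip_intD(2)\<close>)
  moreover have "?U \<in> unip_int (Suc m)" "?V \<in> unip_int (Suc m)"
    using unip_row_zero_in_unip_int[OF u] unip_col_zero_in_unip_int[OF v] by auto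
  ultimately show "h \<in> lower_left m ` dbl_coset (Suc m) g" unfolding dbl_coset_def by blast
qed

text \<open>The first superdiagonal entry of the bordered matrix lies in the zero row, which kills
  the weight \<open>k\<close>; the remaining entries move by one place.\<close>

lemma psi_unip_row:
  assumes "m \<ge> 1" "u \<in> carrier_mat m m"
  shows "psi (Suc m) (k # N) (unip_row m (0\<^sub>m 1 m) u) = psi m N u"
proof -
  obtain l where l: "m = Suc l" using assms by (cases m) auto
  show ?thesis
    using assms unfolding psi_def l diff_Suc_1 sum.lessThan_Suc_shift
    by (simp add: unip_row_def)
qed

text \<open>Here the border contributes the last superdiagonal entry, which lies in the zero column.
  The last weight drops out and the others keep their index.\<close>

lemma psi_unip_col:
  assumes "m \<ge> 1" "v \<in> carrier_mat m m"
  shows "psi (Suc m) N (unip_col m v (0\<^sub>m m 1)) = psi m (take (m - 1) N) v"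
proof -
  obtain l where l: "m = Suc l" using assms by (cases m) auto
  show ?thesis
    using assms unfolding psi_def l diff_Suc_1 sum.lessThan_Suc
    by (simp add: unip_col_def)
qed

section \<open>Passing from size m + 1 to size m\<close>

text \<open>The diagonal entries of \<open>c\<close> depend on \<open>n - i\<close>, so deleting the
  first row leaves the quotients of the shorter tuple. Columns keep their index, and with it their
  sign \<open>(-1) ^ j\<close>.\<close>

lemma cw_mat_Suc:
  assumes ext: "\<forall>k\<le>m. D_ext m D' k = D_ext (Suc m) D k" and "m \<ge> 1"
  shows "cw_mat (Suc m) D = embed m (cw_mat m D')"
proof (rule eq_matI)
  have wc: "cw_mat m D' \<in> carrier_mat m m" by (rule cw_mat_carrier)
  show "dim_row (cw_mat (Suc m) D) = dim_row (embed m (cw_mat m D'))"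
    "dim_col (cw_mat (Suc m) D) = dim_col (embed m (cw_mat m D'))"
    using embed_carrier[OF wc] cw_mat_carrier[of "Suc m" D] by auto
  \<comment> \<open>At \<open>k = m\<close> the left side of \<open>ext\<close> is the default value
    1, so \<open>ext\<close> contains the condition \<open>D_m = 1\<close>. It makes the top right
    entry equal to \<open>(-1) ^ m\<close>, the corner of \<open>embed\<close>.\<close>
  have 1: "D_ext (Suc m) D m = 1" "D_ext (Suc m) D (Suc m) = 1"
    using ext by (auto simp: D_ext_def)
  fix i j assume "i < dim_row (embed m (cw_mat m D'))" "j < dim_col (embed m (cw_mat m D'))"
  then have ij: "i < Suc m" "j < Suc m" using embed_carrier[OF wc] by auto
  show "cw_mat (Suc m) D $$ (i, j) = embed m (cw_mat m D') $$ (i, j)"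
  proof (cases i)
    case 0
    then show ?thesis using ij wc 1 by (auto simp: cw_mat_index embed_def not_less less_Suc_eq)
  next
    case (Suc i')
    show ?thesis
    proof (cases "j = m")
      case True
      then show ?thesis using Suc ij wc by (auto simp: cw_mat_index embed_def)
    next
      case False
      then show ?thesis using Suc ij wc ext by (auto simp: cw_mat_index embed_def)
    qed
  qed
qed

context
  fixes m :: nat and D D' :: "nat list"
  assumes ext: "\<forall>k\<le>m. D_ext m D' k = D_ext (Suc m) D k"
    and pos: "\<forall>k\<le>Suc m. D_ext (Suc m) D k > 0"
    and m: "m \<ge> 1"
begin

lemma D_ext_pos_smaller: "\<forall>k\<le>m. D_ext m D' k > 0"
  using ext pos by auto

lemma bruhat_embed:
  assumes "b1 \<in> unip_real m" "b2 \<in> unip_real m"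
  shows "embed m (b1 * cw_mat m D' * b2) =
    unip_row m (0\<^sub>m 1 m) b1 * cw_mat (Suc m) D * unip_col m b2 (0\<^sub>m m 1)"
  unfolding cw_mat_Suc[OF ext m]
  using assms by (intro embed_mult cw_mat_carrier unip_realD(1))

text \<open>The blocks of the Bruhat factors are Bruhat factors of the block. Unipotent factors have
  determinant 1 and \<open>embed\<close> preserves determinants, so \<open>det g = 1\<close> passes
  to \<open>?W\<close>, then to \<open>?W'\<close>, then to the block.\<close>

lemma lower_left_big_cell:
  assumes g: "g \<in> big_cell (Suc m) D"
  shows "lower_left m g \<in> big_cell m D'"
proof -
  let ?W = "cw_mat (Suc m) D" and ?W' = "cw_mat m D'"
  obtain b1 b2 where b: "b1 \<in> unip_real (Suc m)" "b2 \<in> unip_real (Suc m)" and g': "g = b1 * ?W * b2"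
    using g by (auto simp: big_cell_iff)
  have gc: "g \<in> carrier_mat (Suc m) (Suc m)" and gZ: "elements_mat g \<subseteq> \<int>" and gd: "det g = 1"
    using g by (auto simp: big_cell_iff SL_int_def)
  obtain x u where x: "x \<in> carrier_mat 1 m" "u \<in> unip_real m" "b1 = unip_row m x u"
    using unip_real_rowE[OF b(1)] by metis
  obtain v y where y: "v \<in> unip_real m" "y \<in> carrier_mat m 1" "b2 = unip_col m v y"
    using unip_real_colE[OF b(2)] by metis
  have "lower_left m g = u * lower_left m ?W * v"
    unfolding g' x(3) y(3)
    by (rule lower_left_mult[OF cw_mat_carrier x(1) unip_realD(1)[OF x(2)] y(2) unip_realD(1)[OF y(1)]])
  then have eq: "lower_left m g = u * ?W' * v"
    by (simp add: cw_mat_Suc[OF ext m] lower_left_embed[OF cw_mat_carrier])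
  have "det ?W = 1"
    using gd b[THEN unip_realD(1)] cw_mat_carrier[of "Suc m" D] b[THEN det_unip_real]
    unfolding g' by (simp add: det_mult[of _ "Suc m"])
  then have "det ?W' = 1" by (simp add: cw_mat_Suc[OF ext m] det_embed[OF cw_mat_carrier])
  then have "det (lower_left m g) = 1"
    unfolding eq using unip_realD(1)[OF x(2)] unip_realD(1)[OF y(1)] cw_mat_carrier[of m D']
    by (simp add: det_mult[of _ m] det_unip_real[OF x(2)] det_unip_real[OF y(1)])
  moreover have "elements_mat (lower_left m g) \<subseteq> \<int>"
    using gZ unfolding elements_mat_subset_iff[OF gc] elements_mat_subset_iff[OF lower_left_carrier]
    by (simp add: lower_left_def)
  ultimately show ?thesis
    unfolding big_cell_iff SL_int_def using eq x(2) y(1) lower_left_carrier by blast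
qed

lemma embed_big_cell:
  assumes h: "h \<in> big_cell m D'"
  shows "embed m h \<in> big_cell (Suc m) D"
proof -
  obtain b1 b2 where b: "b1 \<in> unip_real m" "b2 \<in> unip_real m" and h': "h = b1 * cw_mat m D' * b2"
    using h by (auto simp: big_cell_iff)
  have "embed m h = unip_row m (0\<^sub>m 1 m) b1 * cw_mat (Suc m) D * unip_col m b2 (0\<^sub>m m 1)"
    unfolding h' by (rule bruhat_embed[OF b])
  moreover have "unip_row m (0\<^sub>m 1 m) b1 \<in> unip_real (Suc m)"
    "unip_col m b2 (0\<^sub>m m 1) \<in> unip_real (Suc m)"
    using b by (auto intro: unip_row_in_unip_real unip_col_in_unip_real)
  ultimately show ?thesis
    using h embed_in_SL_int unfolding big_cell_iff by blast
qed

text \<open>Bordering preserves the Bruhat factorisation. Reversal moves the last entry of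
  \<open>M\<close> to the front, which is the weight removed by the zero row, while the zero column
  removes the last weight of \<open>N\<close>. So both tuples are truncated at the same end.\<close>

lemma kl_summand_embed:
  assumes h: "h \<in> big_cell m D'" and M: "length M = m"
  shows "kl_summand (Suc m) M N D (embed m h) =
    kl_summand m (take (m - 1) M) (take (m - 1) N) D' h"
proof -
  obtain b1 b2 where b: "b1 \<in> unip_real m" "b2 \<in> unip_real m" and h': "h = b1 * cw_mat m D' * b2"
    using h by (auto simp: big_cell_iff)
  have u: "unip_row m (0\<^sub>m 1 m) b1 \<in> unip_real (Suc m)"
    "unip_col m b2 (0\<^sub>m m 1) \<in> unip_real (Suc m)"
    using b by (auto intro: unip_row_in_unip_real unip_col_in_unip_real)
  have "M = take (m - 1) M @ [M ! (m - 1)]"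
    using M m take_Suc_conv_app_nth[of "m - 1" M] by simp
  then have "rev M = M ! (m - 1) # rev (take (m - 1) M)"
    by (metis rev_eq_Cons_iff rev_rev_ident)
  then show ?thesis
    unfolding kl_summand_def h' bruhat_embed[OF b] mu_eq[OF pos u] mu_eq[OF D_ext_pos_smaller b]
    by (simp only: psi_unip_row[OF m unip_realD(1)[OF b(1)]] psi_unip_col[OF m unip_realD(1)[OF b(2)]])
qed

section \<open>The bijection of double cosets and the comparison of the sums\<close>

lemma dbl_coset_embed_lower_left:
  assumes g: "g \<in> big_cell (Suc m) D"
  shows "dbl_coset (Suc m) (embed m (lower_left m g)) = dbl_coset (Suc m) g"
  using g lower_left_big_cell[OF g]
  by (intro dbl_coset_eq embed_lower_left_in_dbl_coset) (auto simp: big_cell_iff SL_int_def)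

text \<open>Taking images of whole cosets avoids a choice of representatives. A coset is recovered
  by embedding the block of any of its members, which gives injectivity; surjectivity holds because
  \<open>embed\<close> is a section of \<open>lower_left\<close>.\<close>

lemma bij_betw_X_set:
  "bij_betw (image (lower_left m)) (X_set (Suc m) D) (X_set m D')"
proof -
  have carr: "g \<in> carrier_mat n n" if "g \<in> big_cell n E" for g n E
    using that by (auto simp: big_cell_iff SL_int_def)
  have img: "lower_left m ` dbl_coset (Suc m) g = dbl_coset m (lower_left m g)"
    if "g \<in> big_cell (Suc m) D" for g
    using lower_left_dbl_coset carr that by blast
  have "inj_on (image (lower_left m)) (X_set (Suc m) D)"
  proof (rule inj_onI)
    fix X Y
    assume "X \<in> X_set (Suc m) D" "Y \<in> X_set (Suc m) D"
      and eq: "lower_left m ` X = lower_left m ` Y"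
    then obtain g h where g: "g \<in> big_cell (Suc m) D" "X = dbl_coset (Suc m) g"
      and h: "h \<in> big_cell (Suc m) D" "Y = dbl_coset (Suc m) h"
      by (auto simp: X_set_def)
    have "lower_left m g \<in> dbl_coset m (lower_left m h)"
      using eq g h img dbl_coset_refl[OF lower_left_carrier] by metis
    then obtain u v where u: "u \<in> unip_int m" and v: "v \<in> unip_int m"
      and uv: "lower_left m g = u * lower_left m h * v"
      by (auto simp: dbl_coset_def)
    let ?U = "unip_row m (0\<^sub>m 1 m) u" and ?V = "unip_col m v (0\<^sub>m m 1)"
    \<comment> \<open>The factors relating the two blocks lift with zero borders, so the embedded
      blocks, and with them \<open>g\<close> and \<open>h\<close>, lie in one double coset.\<close>
    have "embed m (lower_left m g) = ?U * embed m (lower_left m h) * ?V"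
      unfolding uv using u v by (intro embed_mult lower_left_carrier unip_intD(2))
    moreover have "?U \<in> unip_int (Suc m)" "?V \<in> unip_int (Suc m)"
      using unip_row_zero_in_unip_int[OF u] unip_col_zero_in_unip_int[OF v] by auto
    ultimately have "embed m (lower_left m g) \<in> dbl_coset (Suc m) (embed m (lower_left m h))"
      unfolding dbl_coset_def by blast
    then have "dbl_coset (Suc m) (embed m (lower_left m g)) = dbl_coset (Suc m) (embed m (lower_left m h))"
      by (intro dbl_coset_eq embed_carrier lower_left_carrier)
    then show "X = Y"
      using dbl_coset_embed_lower_left g h by simp
  qed
  moreover have "image (lower_left m) ` X_set (Suc m) D = X_set m D'"
  proof (intro equalityI subsetI)
    fix Y assume "Y \<in> image (lower_left m) ` X_set (Suc m) D"
    then show "Y \<in> X_set m D'" using img lower_left_big_cell by (auto simp: X_set_def)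
  next
    fix Y assume "Y \<in> X_set m D'"
    then obtain h where h: "h \<in> big_cell m D'" "Y = dbl_coset m h" by (auto simp: X_set_def)
    have "Y = lower_left m ` dbl_coset (Suc m) (embed m h)"
      using img[OF embed_big_cell[OF h(1)]] lower_left_embed[OF carr[OF h(1)]] h(2) by simp
    then show "Y \<in> image (lower_left m) ` X_set (Suc m) D"
      using embed_big_cell[OF h(1)] by (auto simp: X_set_def)
  qed
  ultimately show ?thesis by (simp add: bij_betw_def)
qed

lemma kloosterman_Suc:
  assumes M: "length M = m"
  shows "kloosterman (Suc m) M N D = kloosterman m (take (m - 1) M) (take (m - 1) N) D'"
  unfolding kloosterman_alt
proof (subst sum.reindex_bij_betw[OF bij_betw_X_set, symmetric], rule sum.cong[OF refl])
  fix X assume "X \<in> X_set (Suc m) D"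
  then obtain g where g: "g \<in> big_cell (Suc m) D" "X = dbl_coset (Suc m) g"
    by (auto simp: X_set_def)
  let ?h = "lower_left m g"
  have h: "?h \<in> big_cell m D'" using g by (intro lower_left_big_cell)
  have "lower_left m ` X = dbl_coset m ?h"
    using g lower_left_dbl_coset by (auto simp: big_cell_iff SL_int_def)
  \<comment> \<open>Both \<open>SOME\<close> representatives can now be exchanged, for
    \<open>embed m ?h\<close> in \<open>X\<close> and for \<open>?h\<close> in its image, where the
    summands agree.\<close>
  moreover have "X = dbl_coset (Suc m) (embed m ?h)"
    using g dbl_coset_embed_lower_left by simp
  ultimately show "kl_summand (Suc m) M N D (SOME g. g \<in> X) =
      kl_summand m (take (m - 1) M) (take (m - 1) N) D' (SOME g. g \<in> lower_left m ` X)"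
    using kl_summand_some[OF pos embed_big_cell[OF h]] kl_summand_some[OF D_ext_pos_smaller h]
      kl_summand_embed[OF h M] by simp
qed

end

theorem proposition3p7:
  fixes n :: nat and M N :: "int list" and D :: "nat list"
  assumes "n \<ge> 3"
    and "length M = n - 1" and "length N = n - 1" and "length D = n - 1"
    and "\<forall>d \<in> set D. d > 0"
    and "D ! (n - 2) = 1"
  shows "kloosterman n M N D =
    kloosterman (n - 1) (take (n - 2) M) (take (n - 2) N) (take (n - 2) D)"
proof -
  obtain m where n: "n = Suc m" and m: "m \<ge> 2" using assms(1) by (cases n) auto
  \<comment> \<open>Only at \<open>k = m\<close> do the two sides use different branches of
    \<open>D_ext\<close>: the default 1 on the left, and on the right the entry
    \<open>D ! (m - 1)\<close>, which is \<open>D ! (n - 2) = 1\<close>.\<close>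
  have ext: "\<forall>k\<le>m. D_ext m (take (m - 1) D) k = D_ext (Suc m) D k"
    using assms(6) n m by (auto simp: D_ext_def numeral_2_eq_2)
  have pos: "\<forall>k\<le>Suc m. D_ext (Suc m) D k > 0"
    using D_ext_pos[of D "Suc m"] assms(4,5) n by blast
  show ?thesis
    using kloosterman_Suc[OF ext pos, of M N] assms(2) n m by (simp add: numeral_2_eq_2)
qed

end
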